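(* Let $C\subseteq\mathbb{R}^2$ be the interior of a strictly convex body. The growth function of the set system $(\mathbb{R}^2,T_C)$ is at most $n^2-n+2$; that is, for every $n\ge1$, $$\max_{S\subseteq\mathbb{R}^2,\ |S|=n}\bigl|\{S\cap(x+C): x\in\mathbb{R}^2\}\bigr|\le n^2-n+2.$$
   Context: A convex body is a compact convex set with non-empty interior; a set $K$ is strictly convex if for all $x\ne y$ in $K$ and $\lambda\in(0,1)$, $\lambda x+(1-\lambda)y\in\operatorname{int}K$. $T_C=\{x+C:x\in\mathbb{R}^2\}$ is the family of translations of $C$. The growth function of $(\mathbb{R}^2,T_C)$ is $n\mapsto\max_{S\subseteq\mathbb{R}^2,|S|=n}|\{S\cap(x+C):x\in\mathbb{R}^2\}|$. *)

theory Defs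
  imports "HOL-Analysis.Analysis"
begin

definition convex_body :: "'a::euclidean_space set \<Rightarrow> bool" where
  "convex_body K \<longleftrightarrow> compact K \<and> convex K \<and> interior K \<noteq> {}"

definition strictly_convex :: "'a::real_normed_vector set \<Rightarrow> bool" where
  "strictly_convex K \<longleftrightarrow>
     (\<forall>x\<in>K. \<forall>y\<in>K. \<forall>l\<in>{0<..<1}. x \<noteq> y \<longrightarrow> l *\<^sub>R x + (1 - l) *\<^sub>R y \<in> interior K)"

definition translates :: "'a::ab_group_add set \<Rightarrow> 'a set set" where
  "translates C = {(+) x ` C | x. True}"

definition traces :: "'a set set \<Rightarrow> 'a set \<Rightarrow> 'a set set" where
  "traces F S = {S \<inter> A | A. A \<in> F}"

text \<open>
  Finiteness of \<open>S\<close> is required explicitly because \<open>card\<close> of an infinite set is \<open>0\<close>.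
  \<open>Max\<close> is unspecified on empty and on infinite sets; the lemma
  \<open>growth_function_max_attained\<close> shows that neither case arises when \<open>X\<close> is infinite.
\<close>

definition growth_function :: "'a set \<Rightarrow> 'a set set \<Rightarrow> nat \<Rightarrow> nat" where
  "growth_function X F n = Max {card (traces F S) | S. S \<subseteq> X \<and> finite S \<and> card S = n}"

lemma growth_function_max_attained:
  assumes "infinite X"
  shows "finite {card (traces F S) | S. S \<subseteq> X \<and> finite S \<and> card S = n}"
    and "{card (traces F S) | S. S \<subseteq> X \<and> finite S \<and> card S = n} \<noteq> {}"
proof -
  have "card (traces F S) \<le> 2 ^ n" if "finite S" "card S = n" for S
  proof -
    have "traces F S \<subseteq> Pow S" by (auto simp: traces_def)
    then have "card (traces F S) \<le> card (Pow S)" using that by (intro card_mono) auto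
    then show ?thesis using that by (simp add: card_Pow)
  qed
  then have "{card (traces F S) | S. S \<subseteq> X \<and> finite S \<and> card S = n} \<subseteq> {..2 ^ n}" by auto
  then show "finite {card (traces F S) | S. S \<subseteq> X \<and> finite S \<and> card S = n}"
    by (rule finite_subset) simp
  show "{card (traces F S) | S. S \<subseteq> X \<and> finite S \<and> card S = n} \<noteq> {}"
    using infinite_arbitrarily_large[OF assms, of n] by auto
qed

end

theory Submission
  imports Defs
begin

text \<open>
  A point \<open>s\<close> lies in \<open>x + C\<close> iff \<open>x\<close> lies in \<open>s - C\<close>, so the traces on \<open>S\<close> are the
  membership patterns of points \<open>x\<close> with respect to the translates \<open>s - C\<close>, \<open>s \<in> S\<close>. The
  theorem is therefore a bound on the complexity of an arrangement of \<open>n\<close> closed curves, any two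
  of which meet in at most two points.

  The pattern is constant on every connected set that misses all the curves. To count patterns
  by the connected components of the complement of the curves, each pattern has to be realised
  off the curves. This is achieved by shrinking \<open>K\<close> slightly: finitely many open
  conditions \<open>s - x \<in> int K\<close> survive, while the points outside \<open>int K\<close> are outside the shrunk
  closed body (lemma \<open>shrink_keeping_finitely_many\<close>).

  The components are counted by adding the curves one at a time, beginning with the single
  component of the whole plane. A new curve \<open>J\<close> meets the \<open>k\<close> earlier ones in at most \<open>2k\<close> points
  (lemma \<open>frontier_inter_translate_card\<close>), which leave at most \<open>max 1 (2k)\<close> arcs of \<open>J\<close>. Each
  arc has one new component on its inner and one on its outer side, and the new components
  within one old component are connected to each other through arcs. A connected graph has
  at most one vertex more than it has edges, so each arc contributes at most one
  additional component (lemma \<open>card_components_Diff_frontier_le\<close>). The total is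
  \<open>1 + 1 + (\<Sum>k=1..n-1. 2k) = n\<^sup>2 - n + 2\<close>.
\<close>

section \<open>Boundaries of two translates of a planar strictly convex set\<close>

lemma strictly_convexD:
  assumes "strictly_convex K" "x \<in> K" "y \<in> K" "x \<noteq> y" "0 < l" "l < 1"
  shows "l *\<^sub>R x + (1 - l) *\<^sub>R y \<in> interior K"
  using assms unfolding strictly_convex_def by auto

lemma strictly_convex_between:
  fixes K :: "'a::euclidean_space set"
  assumes K: "strictly_convex K" "p - a *\<^sub>R v \<in> K" "p + b *\<^sub>R v \<in> K"
    and "a > 0" "b > 0" "v \<noteq> 0"
  shows "p \<in> interior K"
proof -
  define l where "l = b / (a + b)"
  have l: "0 < l" "l < 1" "(1 - l) * b - l * a = 0"
    using assms(4,5) by (auto simp: l_def field_simps)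
  have "(p + b *\<^sub>R v) - (p - a *\<^sub>R v) = (a + b) *\<^sub>R v" by (simp add: algebra_simps)
  moreover have "(a + b) *\<^sub>R v \<noteq> 0" using assms(4-6) by simp
  ultimately have "p - a *\<^sub>R v \<noteq> p + b *\<^sub>R v" by (metis right_minus_eq)
  then have "l *\<^sub>R (p - a *\<^sub>R v) + (1 - l) *\<^sub>R (p + b *\<^sub>R v) \<in> interior K"
    by (rule strictly_convexD[OF K _ l(1,2)])
  also have "l *\<^sub>R (p - a *\<^sub>R v) + (1 - l) *\<^sub>R (p + b *\<^sub>R v) = p + ((1 - l) * b - l * a) *\<^sub>R v"
    by (simp add: algebra_simps)
  finally show ?thesis using l by simp
qed

text \<open>
  Three chords \<open>[q - v, q]\<close>, equal and parallel, the line of \<open>q2\<close> lying strictly between the other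
  two: the convex combination of the outer chords is a chord \<open>[r - v, r]\<close> of interior points on
  that line. The middle chord is a shift of it by \<open>t *\<^sub>R v\<close>, so one endpoint of the middle chord lies
  between its other endpoint and a point of \<open>[r - v, r]\<close>, hence is interior.
\<close>

lemma no_three_equal_parallel_chords:
  fixes K :: "'a::euclidean_space set"
  assumes K: "strictly_convex K" and "v \<noteq> 0"
    and q1: "q1 \<in> K" "q1 - v \<in> K" and q3: "q3 \<in> K" "q3 - v \<in> K" and "q1 \<noteq> q3"
    and q2: "q2 \<in> K" "q2 \<notin> interior K" "q2 - v \<in> K" "q2 - v \<notin> interior K"
    and l: "0 < l" "l < 1" and eq: "q2 = l *\<^sub>R q1 + (1 - l) *\<^sub>R q3 + t *\<^sub>R v"
  shows False
proof -
  define r where "r = l *\<^sub>R q1 + (1 - l) *\<^sub>R q3"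
  have r: "r \<in> interior K"
    unfolding r_def using strictly_convexD[OF K q1(1) q3(1) \<open>q1 \<noteq> q3\<close> l] .
  have "r - v = l *\<^sub>R (q1 - v) + (1 - l) *\<^sub>R (q3 - v)"
    by (simp add: r_def algebra_simps)
  then have rv: "r - v \<in> interior K"
    using strictly_convexD[OF K q1(2) q3(2) _ l] \<open>q1 \<noteq> q3\<close> by simp
  have in_K: "r \<in> K" "r - v \<in> K" using r rv interior_subset by blast+
  have q2r: "q2 = r + t *\<^sub>R v" using eq r_def by simp
  consider "t = 0" | "t > 0" | "- t > 0" by linarith
  then show False
  proof cases
    case 1
    then show False using q2r r q2 by simp
  next
    case 2
    have "q2 - v - t *\<^sub>R v \<in> K" "q2 - v + 1 *\<^sub>R v \<in> K" using in_K q2 by (auto simp: q2r)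
    from strictly_convex_between[OF K this 2 _ \<open>v \<noteq> 0\<close>] show False using q2 by simp
  next
    case 3
    have "q2 - 1 *\<^sub>R v \<in> K" "q2 + (- t) *\<^sub>R v \<in> K" using in_K q2 by (auto simp: q2r)
    from strictly_convex_between[OF K this _ 3 \<open>v \<noteq> 0\<close>] show False using q2 by simp
  qed
qed

text \<open>Distinct chords \<open>[p - v, p]\<close> and \<open>[q - v, q]\<close> on one line would give three collinear points of \<open>K\<close> of which the middle
  one, \<open>p\<close>, is on the boundary.\<close>

lemma no_overlapping_parallel_chords:
  fixes K :: "'a::euclidean_space set"
  assumes K: "strictly_convex K" and "q \<in> K" "p - v \<in> K" "p \<notin> interior K"
    and "v \<noteq> 0" "t > 0" and eq: "q = p + t *\<^sub>R v"
  shows False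
  using strictly_convex_between[OF K, of p 1 v t] assms by simp

text \<open>
  A point \<open>q\<close> common to both boundaries is the end of a chord \<open>[q - v, q]\<close> of \<open>K\<close>. Three common
  points would yield three such chords on different lines, of which one lies between
  the others.
\<close>

lemma frontier_inter_translate_card:
  fixes K :: "(real^2) set"
  assumes cl: "closed K" and K: "strictly_convex K" and v: "v \<noteq> 0"
  shows "finite (frontier K \<inter> (+) v ` frontier K) \<and> card (frontier K \<inter> (+) v ` frontier K) \<le> 2"
proof -
  define F where "F = frontier K \<inter> (+) v ` frontier K"
  \<comment> \<open>the coordinate transverse to \<open>v\<close>; it orders the lines parallel to \<open>v\<close>\<close>
  define \<phi> where "\<phi> x = x $ 1 * v $ 2 - x $ 2 * v $ 1" for x :: "real^2"
  have mem: "q \<in> K" "q \<notin> interior K" "q - v \<in> K" "q - v \<notin> interior K" if "q \<in> F" for q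
    using that cl by (auto simp: F_def frontier_def)
  have par: "\<exists>t. x = t *\<^sub>R v" if "\<phi> x = 0" for x
  proof (cases "v $ 1 = 0")
    case True
    then have "v $ 2 \<noteq> 0" using v by (auto simp: vec_eq_iff forall_2)
    then have "x = (x $ 2 / v $ 2) *\<^sub>R v"
      using that True by (auto simp: vec_eq_iff forall_2 \<phi>_def)
    then show ?thesis by blast
  next
    case False
    then have "x = (x $ 1 / v $ 1) *\<^sub>R v"
      using that by (auto simp: vec_eq_iff forall_2 \<phi>_def field_simps)
    then show ?thesis by blast
  qed
  have lin: "\<phi> (x - y) = \<phi> x - \<phi> y" "\<phi> (x + y) = \<phi> x + \<phi> y" "\<phi> (c *\<^sub>R x) = c * \<phi> x" for x y c
    by (auto simp: \<phi>_def algebra_simps)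
  have inj: "inj_on \<phi> F"
  proof (rule inj_onI, rule ccontr)
    fix p q assume pq: "p \<in> F" "q \<in> F" "\<phi> p = \<phi> q" "p \<noteq> q"
    then obtain t where t: "q - p = t *\<^sub>R v" using par[of "q - p"] lin by auto
    then have "t \<noteq> 0" using pq by auto
    then consider "t > 0" | "- t > 0" by linarith
    then show False
    proof cases
      case 1
      then show False
        using no_overlapping_parallel_chords[OF K _ _ _ v 1, of q p] mem[OF pq(1)] mem[OF pq(2)] t
        by (metis add.commute diff_add_cancel)
    next
      case 2
      have "p = q + (- t) *\<^sub>R v" using t by (simp add: algebra_simps)
      then show False
        using no_overlapping_parallel_chords[OF K _ _ _ v 2, of p q] mem[OF pq(1)] mem[OF pq(2)]
        by blast
    qed
  qed
  have no3: False if q: "q1 \<in> F" "q2 \<in> F" "q3 \<in> F" and less: "\<phi> q1 < \<phi> q2" "\<phi> q2 < \<phi> q3" for q1 q2 q3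
  proof -
    define l where "l = (\<phi> q3 - \<phi> q2) / (\<phi> q3 - \<phi> q1)"
    have l: "0 < l" "l < 1" using less by (auto simp: l_def)
    have "l * (\<phi> q3 - \<phi> q1) = \<phi> q3 - \<phi> q2" using less by (simp add: l_def)
    then have "\<phi> (q2 - (l *\<^sub>R q1 + (1 - l) *\<^sub>R q3)) = 0"
      by (simp add: lin algebra_simps)
    then obtain t where "q2 - (l *\<^sub>R q1 + (1 - l) *\<^sub>R q3) = t *\<^sub>R v" using par by blast
    then have "q2 = l *\<^sub>R q1 + (1 - l) *\<^sub>R q3 + t *\<^sub>R v" by (simp add: algebra_simps)
    moreover have "q1 \<noteq> q3" using less by auto
    ultimately show False
      using no_three_equal_parallel_chords[OF K v _ _ _ _ _ _ _ _ _ l, of q1 q3 q2 t]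
        mem[OF q(1)] mem[OF q(2)] mem[OF q(3)] by blast
  qed
  have "card G \<le> 2" if G: "G \<subseteq> F" "finite G" for G
  proof (rule ccontr)
    assume "\<not> card G \<le> 2"
    then obtain H where H: "H \<subseteq> G" "card H = 3"
      using obtain_subset_with_card_n[of 3 G] by (metis not_less_eq_eq numeral_2_eq_2 numeral_3_eq_3)
    then obtain a b c where "H = {a, b, c}" and d: "a \<noteq> b" "b \<noteq> c" "a \<noteq> c" by (auto simp: card_3_iff)
    then have m: "a \<in> F" "b \<in> F" "c \<in> F" using H G by auto
    then have "\<phi> a \<noteq> \<phi> b" "\<phi> b \<noteq> \<phi> c" "\<phi> a \<noteq> \<phi> c" using inj d by (auto dest: inj_onD)
    then show False using no3 m by (metis linorder_neqE_linordered_idom)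
  qed
  then show ?thesis unfolding F_def by (rule finite_if_finite_subsets_card_bdd)
qed

section \<open>Cutting an open set along a two-sided closed set\<close>

text \<open>
  The graph-theoretic core: a graph has at least as many connected components as
  vertices minus edges. Instead of components, \<open>c\<close> is any labelling constant along edges; each
  edge is contracted by identifying two labels, which loses at most one label. The labelling
  works for all finite vertex sets at once, so finiteness of the vertex set can be deduced from it.
\<close>

lemma merge_along_edges:
  fixes E :: "('v \<times> 'v) set"
  assumes "finite E"
  shows "\<exists>c :: 'v \<Rightarrow> 'v. (\<forall>(a, b) \<in> E. c a = c b) \<and>
           (\<forall>G. finite G \<longrightarrow> card G \<le> card (c ` G) + card E)"
  using assms
proof induction
  case empty
  show ?case by (intro exI[of _ id]) simp
next
  case (insert e E)
  obtain a b where e: "e = (a, b)" by (cases e)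
  from insert.IH obtain c :: "'v \<Rightarrow> 'v" where c: "\<forall>(x, y) \<in> E. c x = c y"
    and card_c: "\<forall>G. finite G \<longrightarrow> card G \<le> card (c ` G) + card E" by (elim exE conjE)
  define c' where "c' v = (if c v = c b then c a else c v)" for v
  have "card G \<le> card (c' ` G) + card (insert e E)" if "finite G" for G
  proof -
    have "c ` G \<subseteq> insert (c b) (c' ` G)" by (auto simp: c'_def)
    then have "card (c ` G) \<le> card (insert (c b) (c' ` G))" using that by (intro card_mono) auto
    also have "\<dots> \<le> Suc (card (c' ` G))" using that by (intro card_insert_le_m1) auto
    finally show ?thesis using card_c[rule_format, OF that] insert.hyps by simp
  qed
  then show ?case using c e by (intro exI[of _ c']) (auto simp: c'_def)
qed

text \<open>
  The pair \<open>L q\<close> names the components of \<open>U - J\<close> on the two sides of \<open>J\<close> near \<open>q\<close>. These pairs are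
  the edges of a graph on the components of \<open>U - J\<close>, and a labelling \<open>c\<close> of these that is constant
  along edges extends over \<open>J\<close> to a locally constant function \<open>\<Phi>\<close> on \<open>U\<close>. It is constant on every
  component of \<open>U\<close>, so \<open>c\<close> takes at most as many values as \<open>U\<close> has components.
\<close>

lemma card_components_Diff_le:
  fixes U J :: "'a::real_normed_vector set" and L :: "'a \<Rightarrow> 'a set \<times> 'a set"
  assumes "open U" "closed J" and finU: "finite (components U)" and finL: "finite (L ` (J \<inter> U))"
    and L: "\<And>q. q \<in> J \<inter> U \<Longrightarrow> \<exists>\<delta>>0. \<forall>y \<in> ball q \<delta>. if y \<in> J then L y = L q
              else connected_component_set (U - J) y \<in> {fst (L q), snd (L q)}"
  shows "finite (components (U - J)) \<and>
         card (components (U - J)) \<le> card (components U) + card (L ` (J \<inter> U))"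
proof (rule finite_if_finite_subsets_card_bdd)
  obtain c :: "'a set \<Rightarrow> 'a set" where c: "\<forall>(a, b) \<in> L ` (J \<inter> U). c a = c b"
    and card_c: "\<forall>G. finite G \<longrightarrow> card G \<le> card (c ` G) + card (L ` (J \<inter> U))"
    using merge_along_edges[OF finL] by (elim exE conjE)
  define \<Phi> where "\<Phi> x = c (if x \<in> J then fst (L x) else connected_component_set (U - J) x)" for x
  have loc: "eventually (\<lambda>y. \<Phi> x = \<Phi> y) (at x within W)" if "x \<in> U" for x W
  proof (cases "x \<in> J")
    case True
    then have xJU: "x \<in> J \<inter> U" using that by blast
    obtain \<delta> where "\<delta> > 0" and \<delta>: "\<forall>y \<in> ball x \<delta>. if y \<in> J then L y = L x
              else connected_component_set (U - J) y \<in> {fst (L x), snd (L x)}"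
      using L[OF xJU] by (elim exE conjE)
    have "c (fst (L x)) = c (snd (L x))" using c True that by (auto simp: case_prod_beta)
    then have "\<Phi> x = \<Phi> y" if "y \<in> ball x \<delta>" for y
      using bspec[OF \<delta> that] True by (auto simp: \<Phi>_def split: if_splits)
    then show ?thesis
      using \<open>\<delta> > 0\<close> unfolding eventually_at by (intro exI[of _ \<delta>]) (auto simp: dist_commute)
  next
    case False
    then have "x \<in> U - J" "open (U - J)" using that assms by auto
    then obtain \<delta> where "\<delta> > 0" and \<delta>: "ball x \<delta> \<subseteq> U - J" by (meson openE)
    have "\<Phi> x = \<Phi> y" if y: "y \<in> ball x \<delta>" for y
    proof -
      have "ball x \<delta> \<subseteq> connected_component_set (U - J) x"
        using \<open>\<delta> > 0\<close> \<delta> by (intro connected_component_maximal) auto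
      then have "connected_component_set (U - J) y = connected_component_set (U - J) x"
        using y by (intro connected_component_eq) auto
      then show ?thesis using y \<delta> False by (auto simp: \<Phi>_def)
    qed
    then show ?thesis
      using \<open>\<delta> > 0\<close> unfolding eventually_at by (intro exI[of _ \<delta>]) (auto simp: dist_commute)
  qed
  fix G assume G: "G \<subseteq> components (U - J)" "finite G"
  have rep: "\<exists>w W. w \<in> W \<and> W \<in> components U \<and> c Z = \<Phi> w" if "Z \<in> G" for Z
  proof -
    have "Z \<in> components (U - J)" using that G by blast
    then obtain w where w: "w \<in> U - J" "Z = connected_component_set (U - J) w"
      by (rule componentsE)
    then have "w \<in> connected_component_set U w" "connected_component_set U w \<in> components U"
      by (auto intro: componentsI)
    moreover have "c Z = \<Phi> w" using w by (simp add: \<Phi>_def)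
    ultimately show ?thesis by blast
  qed
  have const: "\<Phi> x = \<Phi> y" if "x \<in> W" "y \<in> W" "W \<in> components U" for x y W
  proof (rule connected_local_const[of W])
    show "connected W" using that in_components_connected by blast
    show "\<forall>a\<in>W. \<forall>\<^sub>F b in at a within W. \<Phi> a = \<Phi> b"
      using loc that in_components_subset by blast
  qed (use that in auto)
  have "c ` G \<subseteq> (\<lambda>W. \<Phi> (SOME w. w \<in> W)) ` components U"
  proof
    fix z assume "z \<in> c ` G"
    then obtain w W where "w \<in> W" "W \<in> components U" "z = \<Phi> w" using rep by blast
    then show "z \<in> (\<lambda>W. \<Phi> (SOME w. w \<in> W)) ` components U"
      using const[of w W "SOME w. w \<in> W"] someI[of "\<lambda>w. w \<in> W" w] by blast
  qed
  then have "card (c ` G) \<le> card (components U)" using finU by (rule surj_card_le[rotated])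
  then show "card G \<le> card (components U) + card (L ` (J \<inter> U))" using card_c[rule_format, OF G(2)] by simp
qed

section \<open>Cutting along the boundary of a planar convex body\<close>

text \<open>
  Near a boundary point the interior of \<open>B\<close> is convex, hence connected. For the exterior, let \<open>o'\<close>
  be an interior point and \<open>w = q - o'\<close>: moving an exterior point \<open>u\<close> near \<open>q\<close> in direction \<open>w\<close>
  never enters \<open>B\<close>, and after a fixed distance all these points are in one small ball around
  \<open>q + s *\<^sub>R w\<close> disjoint from \<open>B\<close>. Since only connected sets containing the two sides are required,
  the segments and that ball may leave the neighbourhood \<open>ball q \<delta>\<close>.
\<close>

lemma convex_body_two_sided:
  fixes B U :: "'a::euclidean_space set"
  assumes B: "convex_body B" and "open U" and q: "q \<in> frontier B" "q \<in> U"
  obtains \<delta> P Q where "\<delta> > 0" "ball q \<delta> \<subseteq> U"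
    "connected P" "P \<subseteq> U - frontier B" "ball q \<delta> \<inter> interior B \<subseteq> P"
    "connected Q" "Q \<subseteq> U - frontier B" "ball q \<delta> - B \<subseteq> Q"
proof -
  have cvx: "convex B" and cl: "closed B" using B by (auto simp: convex_body_def compact_imp_closed)
  obtain o' r where r: "r > 0" "ball o' r \<subseteq> B"
    using B by (auto simp: convex_body_def mem_interior)
  then have o': "o' \<in> interior B" by (auto simp: mem_interior)
  have qB: "q \<in> B" "q \<notin> interior B" using q cl by (auto simp: frontier_def)
  obtain \<epsilon> where e: "\<epsilon> > 0" "ball q \<epsilon> \<subseteq> U" using \<open>open U\<close> q by (meson openE)
  define w where "w = q - o'"
  have "w \<noteq> 0" using o' qB by (auto simp: w_def)
  define s where "s = \<epsilon> / (2 * norm w)"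
  have s: "s > 0" "s * norm w = \<epsilon> / 2" using e \<open>w \<noteq> 0\<close> by (auto simp: s_def)
  have out: "u + t *\<^sub>R w \<notin> B" if u: "u \<notin> B" "u \<in> ball q r" and "t \<ge> 0" for u t
  proof
    assume a: "u + t *\<^sub>R w \<in> B"
    have "u - w \<in> ball o' r" using u by (simp add: w_def dist_norm algebra_simps)
    then have b: "u - w \<in> B" using r by auto
    \<comment> \<open>\<open>u\<close> lies between \<open>u + t *\<^sub>R w\<close> and \<open>u - w\<close>, a point close to \<open>o'\<close>\<close>
    have "(1 / (1 + t)) *\<^sub>R (u + t *\<^sub>R w) + (t / (1 + t)) *\<^sub>R (u - w) \<in> B"
      using cvx a b \<open>t \<ge> 0\<close> by (intro convexD) (auto simp: field_simps)
    moreover have "(1 / (1 + t)) *\<^sub>R (u + t *\<^sub>R w) + (t / (1 + t)) *\<^sub>R (u - w) = u"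
    proof -
      have "(1 / (1 + t)) *\<^sub>R (u + t *\<^sub>R w) + (t / (1 + t)) *\<^sub>R (u - w) = (1 / (1 + t) + t / (1 + t)) *\<^sub>R u"
        by (simp add: algebra_simps)
      also have "1 / (1 + t) + t / (1 + t) = 1" using \<open>t \<ge> 0\<close> by (simp add: field_simps)
      finally show ?thesis by simp
    qed
    ultimately show False using u by simp
  qed
  have "q + s *\<^sub>R w \<notin> B"
  proof
    assume a: "q + s *\<^sub>R w \<in> B"
    have "(q + s *\<^sub>R w) - (s / (1 + s)) *\<^sub>R ((q + s *\<^sub>R w) - o') \<in> interior B"
      using mem_interior_convex_shrink[OF cvx o' a, of "s / (1 + s)"] s by (auto simp: field_simps)
    moreover have "(q + s *\<^sub>R w) - (s / (1 + s)) *\<^sub>R ((q + s *\<^sub>R w) - o') = q"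
    proof -
      have "(q + s *\<^sub>R w) - o' = (1 + s) *\<^sub>R w" by (simp add: w_def algebra_simps)
      then show ?thesis using s by simp
    qed
    ultimately show False using qB by simp
  qed
  then obtain \<eta> where eta: "\<eta> > 0" "ball (q + s *\<^sub>R w) \<eta> \<subseteq> - B"
    using cl by (meson ComplI open_Compl openE)
  define \<delta> where "\<delta> = Min {\<epsilon> / 2, r, \<eta>}"
  have d: "\<delta> > 0" "\<delta> \<le> \<epsilon> / 2" "\<delta> \<le> r" "\<delta> \<le> \<eta>" using e r eta by (auto simp: \<delta>_def)
  have dU: "ball q \<delta> \<subseteq> U" using e d by force
  define C0 where "C0 = ball (q + s *\<^sub>R w) \<delta>"
  define seg where "seg u = closed_segment u (u + s *\<^sub>R w)" for u
  define Q where "Q = (\<Union>u \<in> ball q \<delta> - B. seg u \<union> C0) \<union> C0"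
  have C0: "C0 \<subseteq> U - B"
  proof
    fix x assume x: "x \<in> C0"
    have "dist q x \<le> dist q (q + s *\<^sub>R w) + dist (q + s *\<^sub>R w) x" by (rule dist_triangle)
    also have "\<dots> < \<epsilon> / 2 + \<delta>" using x s by (simp add: C0_def dist_norm)
    finally have "x \<in> U" using e d by auto
    moreover have "x \<in> ball (q + s *\<^sub>R w) \<eta>" using x d by (simp add: C0_def)
    ultimately show "x \<in> U - B" using eta by blast
  qed
  have seg: "seg u \<subseteq> U - B" if u: "u \<in> ball q \<delta> - B" for u
  proof
    fix x assume "x \<in> seg u"
    then obtain a where a: "0 \<le> a" "a \<le> 1" "x = u + (a * s) *\<^sub>R w"
      by (auto simp: seg_def closed_segment_def algebra_simps)
    have "x \<notin> B" using out[of u "a * s"] u a s d by auto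
    have "dist q x \<le> dist q u + dist u x" by (rule dist_triangle)
    also have "\<dots> = dist q u + a * (s * norm w)" using a s by (simp add: dist_norm abs_mult)
    also have "\<dots> \<le> dist q u + 1 * (s * norm w)" using a s by (intro add_left_mono mult_right_mono) auto
    also have "\<dots> < \<epsilon>" using u d s by auto
    finally show "x \<in> U - B" using e \<open>x \<notin> B\<close> by auto
  qed
  have conn: "connected (seg u \<union> C0)" if "u \<in> ball q \<delta> - B" for u
  proof (rule connected_Un)
    have "u + s *\<^sub>R w \<in> seg u \<inter> C0" using that by (simp add: seg_def C0_def dist_norm)
    then show "seg u \<inter> C0 \<noteq> {}" by blast
  qed (auto simp: seg_def C0_def)
  have "connected Q"
  proof -
    have "connected (\<Union> (insert C0 ((\<lambda>u. seg u \<union> C0) ` (ball q \<delta> - B))))"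
    proof (rule connected_Union)
      have "q + s *\<^sub>R w \<in> C0" using d by (simp add: C0_def)
      then show "\<Inter> (insert C0 ((\<lambda>u. seg u \<union> C0) ` (ball q \<delta> - B))) \<noteq> {}" by blast
    qed (use conn C0_def in auto)
    then show ?thesis by (simp add: Q_def Un_commute)
  qed
  show thesis
  proof
    show "\<delta> > 0" "ball q \<delta> \<subseteq> U" by fact+
    show "connected (ball q \<delta> \<inter> interior B)"
      using cvx by (intro convex_connected convex_Int) auto
    show "ball q \<delta> \<inter> interior B \<subseteq> U - frontier B" using dU by (auto simp: frontier_def)
    show "connected Q" by fact
    show "Q \<subseteq> U - frontier B"
    proof -
      have "Q \<subseteq> U - B" unfolding Q_def using seg C0 by blast
      then show ?thesis using cl by (auto simp: frontier_def)
    qed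
    show "ball q \<delta> - B \<subseteq> Q" by (auto simp: Q_def seg_def)
  qed simp
qed

text \<open>The number of points of \<open>T\<close> to the left of \<open>x\<close> determines the interval of the complement of \<open>T\<close>
  that contains \<open>x\<close>, hence \<open>f x\<close>.\<close>

lemma card_image_locally_const:
  fixes f :: "real \<Rightarrow> 'b" and T :: "real set"
  assumes fin: "finite T"
    and loc: "\<And>x. x \<in> - T \<Longrightarrow> eventually (\<lambda>y. f x = f y) (at x within - T)"
  shows "finite (f ` (- T)) \<and> card (f ` (- T)) \<le> Suc (card T)"
proof -
  define pos where "pos x = card {t \<in> T. t < x}" for x
  have mono: "f x = f y" if xy: "x \<le> y" "x \<in> - T" "y \<in> - T" "pos x = pos y" for x y
  proof -
    have same: "{t \<in> T. t < x} = {t \<in> T. t < y}"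
      using xy fin by (intro card_subset_eq) (auto simp: pos_def)
    have sub: "{x..y} \<subseteq> - T"
    proof (intro subsetI ComplI)
      fix t assume t: "t \<in> {x..y}" "t \<in> T"
      then have "t \<noteq> y" using xy by blast
      then have "t < y" "\<not> t < x" using t by auto
      then show False using same \<open>t \<in> T\<close> by blast
    qed
    have "\<forall>a\<in>{x..y}. \<forall>\<^sub>F b in at a within {x..y}. f a = f b"
    proof
      fix a assume "a \<in> {x..y}"
      then have "a \<in> - T" using sub by blast
      then show "\<forall>\<^sub>F b in at a within {x..y}. f a = f b"
        by (rule filter_leD[OF at_le[OF sub] loc])
    qed
    then show ?thesis using xy by (intro connected_local_const[of "{x..y}"]) auto
  qed
  have eq: "f x = f y" if "x \<in> - T" "y \<in> - T" "pos x = pos y" for x y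
    by (rule linorder_le_cases[of x y]) (use mono that in metis)+
  have "f ` (- T) \<subseteq> (\<lambda>k. f (SOME x. x \<in> - T \<and> pos x = k)) ` {..card T}"
  proof
    fix z assume "z \<in> f ` (- T)"
    then obtain x where x: "x \<in> - T" "z = f x" by blast
    have "(SOME y. y \<in> - T \<and> pos y = pos x) \<in> - T \<and> pos (SOME y. y \<in> - T \<and> pos y = pos x) = pos x"
      by (rule someI[of _ x]) (use x in auto)
    then have "z = f (SOME y. y \<in> - T \<and> pos y = pos x)" using eq x by metis
    moreover have "pos x \<in> {..card T}" using fin by (auto simp: pos_def intro: card_mono)
    ultimately show "z \<in> (\<lambda>k. f (SOME x. x \<in> - T \<and> pos x = k)) ` {..card T}" by blast
  qed
  from finite_subset[OF this] surj_card_le[OF _ this] show ?thesis by simp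
qed

text \<open>
  This counts the arcs into which \<open>m = card (frontier B - U)\<close> points cut a closed curve: \<open>m\<close> arcs if
  \<open>m \<ge> 1\<close>, and one if \<open>m = 0\<close>. Removing one of the points turns the curve into a line cut by the
  remaining \<open>m - 1\<close> points.
\<close>

lemma card_image_locally_const_frontier:
  fixes B :: "(real^2) set" and L :: "real^2 \<Rightarrow> 'b"
  assumes B: "convex_body B" and fin: "finite (frontier B - U)"
    and loc: "\<And>q. q \<in> frontier B \<inter> U \<Longrightarrow> eventually (\<lambda>y. L q = L y) (at q within frontier B \<inter> U)"
  shows "finite (L ` (frontier B \<inter> U)) \<and> card (L ` (frontier B \<inter> U)) \<le> max 1 (card (frontier B - U))"
proof -
  have cvx: "convex B" and bd: "bounded B" and int: "interior B \<noteq> {}"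
    using B by (auto simp: convex_body_def compact_imp_bounded)
  have dim: "aff_dim B = 2" using int by (simp add: aff_dim_nonempty_interior)
  have rf: "rel_frontier B = frontier B" using int by (simp add: rel_frontier_nonempty_interior)
  show ?thesis
  proof (cases "frontier B \<subseteq> U")
    case True
    then have eq: "frontier B \<inter> U = frontier B" by blast
    have "connected (frontier B)"
      using connected_sphere_gen[OF cvx bd] dim rf by simp
    then have const: "L x = L y" if "x \<in> frontier B" "y \<in> frontier B" for x y
      using that loc unfolding eq by (intro connected_local_const[of "frontier B"]) auto
    have "L ` (frontier B) \<subseteq> {L (SOME x. x \<in> frontier B)}"
    proof clarify
      fix x assume "x \<in> frontier B"
      then show "L x = L (SOME x. x \<in> frontier B)"
        using const someI[of "\<lambda>x. x \<in> frontier B" x] by blast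
    qed
    then have "finite (L ` (frontier B)) \<and> card (L ` (frontier B)) \<le> 1"
      using card_mono[of "{L (SOME x. x \<in> frontier B)}"] by (auto intro: finite_subset)
    then show ?thesis unfolding eq by linarith
  next
    case False
    then obtain q0 where q0: "q0 \<in> frontier B" "q0 \<notin> U" by blast
    have "rel_frontier B - {q0} homeomorphic (UNIV :: real set)"
      using cvx bd q0 rf dim by (intro homeomorphic_punctured_sphere_affine_gen) auto
    then have "(UNIV :: real set) homeomorphic (frontier B - {q0})"
      unfolding rf by (rule homeomorphic_sym[THEN iffD1])
    then obtain g h where gh: "homeomorphism (UNIV :: real set) (frontier B - {q0}) g h"
      unfolding homeomorphic_def by (elim exE)
    then have g: "continuous_on UNIV g" "g ` UNIV = frontier B - {q0}" "inj g"
      unfolding homeomorphism_def by (auto intro: inj_on_inverseI)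
    define T where "T = {t. g t \<notin> U}"
    have gT: "g ` T = frontier B - U - {q0}"
    proof -
      have "g ` T = range g - U" by (auto simp: T_def)
      also have "\<dots> = frontier B - U - {q0}" unfolding g(2) by blast
      finally show ?thesis .
    qed
    have cT: "card T = card (frontier B - U - {q0})"
      using g(3) gT by (metis card_image inj_on_subset subset_UNIV)
    then have Suc: "Suc (card T) = card (frontier B - U)"
      using card_Suc_Diff1[of "frontier B - U" q0] q0 fin by simp
    have "finite T" using gT fin g(3) by (metis finite_Diff finite_imageD inj_on_subset subset_UNIV)
    have im: "g ` (- T) = frontier B \<inter> U"
    proof -
      have "g ` (- T) = range g \<inter> U" by (auto simp: T_def)
      also have "\<dots> = frontier B \<inter> U" unfolding g(2) using q0 by blast
      finally show ?thesis .
    qed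
    have "\<forall>\<^sub>F y in at x within - T. L (g x) = L (g y)" if x: "x \<in> - T" for x
    proof -
      have "eventually (\<lambda>y. L (g x) = L y) (at (g x) within frontier B \<inter> U)" using loc x im by blast
      then obtain S where S: "open S" "g x \<in> S" "\<And>y. y \<in> S \<Longrightarrow> y \<noteq> g x \<Longrightarrow> y \<in> frontier B \<inter> U \<Longrightarrow> L (g x) = L y"
        unfolding eventually_at_topological by blast
      have "open (g -` S)" using g(1) S(1) by (simp add: open_vimage)
      then show ?thesis unfolding eventually_at_topological
        by (intro exI[of _ "g -` S"]) (use S im in \<open>auto, metis Int_iff ComplI imageI\<close>)
    qed
    from card_image_locally_const[OF \<open>finite T\<close>, of "L \<circ> g"] this
    have "finite ((L \<circ> g) ` (- T)) \<and> card ((L \<circ> g) ` (- T)) \<le> Suc (card T)" by simp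
    then show ?thesis unfolding image_comp[symmetric] im Suc by linarith
  qed
qed

text \<open>
  By \<open>convex_body_two_sided\<close> every point of the curve inside \<open>U\<close> determines a component on its inner and one
  on its outer side. This pair is locally constant along the curve, so it takes at most as many
  values as there are arcs.
\<close>

lemma card_components_Diff_frontier_le:
  fixes B U :: "(real^2) set"
  assumes B: "convex_body B" and U: "open U" "finite (components U)" and fin: "finite (frontier B - U)"
  shows "finite (components (U - frontier B)) \<and>
    card (components (U - frontier B)) \<le> card (components U) + max 1 (card (frontier B - U))"
proof -
  have cl: "closed B" and cvx: "convex B" and int: "interior B \<noteq> {}"
    using B by (auto simp: convex_body_def compact_imp_closed)
  define J where "J = frontier B"
  define side where "side q ab \<longleftrightarrow> (\<exists>\<delta>>0. ball q \<delta> \<subseteq> U \<and>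
      (\<forall>y \<in> ball q \<delta> \<inter> interior B. connected_component_set (U - J) y = fst ab) \<and>
      (\<forall>y \<in> ball q \<delta> - B. connected_component_set (U - J) y = snd ab))" for q ab
  have ex: "\<exists>ab. side q ab" if q: "q \<in> J \<inter> U" for q
  proof -
    from q obtain \<delta> P Q where d: "\<delta> > 0" "ball q \<delta> \<subseteq> U"
      "connected P" "P \<subseteq> U - J" "ball q \<delta> \<inter> interior B \<subseteq> P"
      "connected Q" "Q \<subseteq> U - J" "ball q \<delta> - B \<subseteq> Q"
      using convex_body_two_sided[OF B U(1), of q thesis] unfolding J_def by blast
    have comp: "\<exists>c. \<forall>y\<in>X. connected_component_set (U - J) y = c" if "connected X" "X \<subseteq> U - J" for X
    proof (cases "X = {}")
      case False
      then obtain x where "x \<in> X" by blast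
      then have "X \<subseteq> connected_component_set (U - J) x" using that by (intro connected_component_maximal)
      then show ?thesis by (meson connected_component_eq subsetD)
    qed auto
    obtain a where a: "\<forall>y\<in>P. connected_component_set (U - J) y = a"
      using comp[OF d(3,4)] by (elim exE)
    obtain b where b: "\<forall>y\<in>Q. connected_component_set (U - J) y = b"
      using comp[OF d(6,7)] by (elim exE)
    have "side q (a, b)"
      unfolding side_def using a b d(1,2,5,8) by (intro exI[of _ \<delta>]) (simp add: subset_iff)
    then show ?thesis by blast
  qed
  \<comment> \<open>both sides of the curve accumulate at \<open>q\<close>, so the two components are determined by \<open>q\<close>\<close>
  have uniq: "ab = cd" if q: "q \<in> J" and "side q ab" "side q cd" for q ab cd
  proof -
    from \<open>side q ab\<close> obtain \<delta>1 where "\<delta>1 > 0"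
      and 1: "\<forall>y \<in> ball q \<delta>1 \<inter> interior B. connected_component_set (U - J) y = fst ab"
        "\<forall>y \<in> ball q \<delta>1 - B. connected_component_set (U - J) y = snd ab"
      unfolding side_def by (elim exE conjE)
    from \<open>side q cd\<close> obtain \<delta>2 where "\<delta>2 > 0"
      and 2: "\<forall>y \<in> ball q \<delta>2 \<inter> interior B. connected_component_set (U - J) y = fst cd"
        "\<forall>y \<in> ball q \<delta>2 - B. connected_component_set (U - J) y = snd cd"
      unfolding side_def by (elim exE conjE)
    define \<delta> where "\<delta> = min \<delta>1 \<delta>2"
    have "\<delta> > 0" using \<open>\<delta>1 > 0\<close> \<open>\<delta>2 > 0\<close> by (simp add: \<delta>_def)
    have "q \<in> closure (interior B)"
      using q cl cvx int by (auto simp: J_def frontier_def convex_closure_interior)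
    then obtain y where y: "y \<in> ball q \<delta> \<inter> interior B"
      using \<open>\<delta> > 0\<close> by (auto simp: closure_approachable dist_commute)
    have "q \<in> closure (- B)" using q by (auto simp: J_def frontier_def closure_complement)
    then obtain z where z: "z \<in> ball q \<delta> - B"
      using \<open>\<delta> > 0\<close> by (auto simp: closure_approachable dist_commute)
    have "y \<in> ball q \<delta>1 \<inter> interior B" "y \<in> ball q \<delta>2 \<inter> interior B"
      "z \<in> ball q \<delta>1 - B" "z \<in> ball q \<delta>2 - B" using y z by (auto simp: \<delta>_def)
    then show ?thesis using 1 2 by (metis prod_eqI)
  qed
  define L where "L q = (SOME ab. side q ab)" for q
  have sideL: "side q (L q)" if "q \<in> J \<inter> U" for q
    unfolding L_def using someI_ex[OF ex[OF that]] .
  have near: "\<exists>\<delta>>0. \<forall>y \<in> ball q \<delta>. if y \<in> J then L y = L q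
              else connected_component_set (U - J) y \<in> {fst (L q), snd (L q)}"
    if q: "q \<in> J \<inter> U" for q
  proof -
    from sideL[OF q] obtain \<delta> where "\<delta> > 0" and d: "ball q \<delta> \<subseteq> U"
      "\<And>y. y \<in> ball q \<delta> \<inter> interior B \<Longrightarrow> connected_component_set (U - J) y = fst (L q)"
      "\<And>y. y \<in> ball q \<delta> - B \<Longrightarrow> connected_component_set (U - J) y = snd (L q)"
      unfolding side_def by meson
    have "L y = L q" if y: "y \<in> ball q \<delta>" "y \<in> J" for y
    proof -
      obtain \<rho> where "\<rho> > 0" "ball y \<rho> \<subseteq> ball q \<delta>" using y(1) open_ball openE by metis
      then have "side y (L q)" unfolding side_def using d by (intro exI[of _ \<rho>]) blast
      then show ?thesis using uniq y sideL d by blast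
    qed
    moreover have "connected_component_set (U - J) y \<in> {fst (L q), snd (L q)}"
      if "y \<in> ball q \<delta>" "y \<notin> J" for y
      using d that cl by (auto simp: J_def frontier_def)
    ultimately show ?thesis using \<open>\<delta> > 0\<close> by (intro exI[of _ \<delta>]) auto
  qed
  have "finite (L ` (J \<inter> U)) \<and> card (L ` (J \<inter> U)) \<le> max 1 (card (J - U))"
    unfolding J_def
  proof (rule card_image_locally_const_frontier[OF B fin])
    fix q assume "q \<in> frontier B \<inter> U"
    then have "q \<in> J \<inter> U" by (simp add: J_def)
    from near[OF this] obtain \<delta> where "\<delta> > 0" and d: "\<forall>y \<in> ball q \<delta>. if y \<in> J then L y = L q
              else connected_component_set (U - J) y \<in> {fst (L q), snd (L q)}"
      by (elim exE conjE)
    have "L q = L y" if "y \<in> ball q \<delta>" "y \<in> J" for y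
      using bspec[OF d that(1)] that(2) by simp
    then show "\<forall>\<^sub>F y in at q within frontier B \<inter> U. L q = L y"
      using \<open>\<delta> > 0\<close> unfolding eventually_at J_def by (intro exI[of _ \<delta>]) (auto simp: dist_commute)
  qed
  moreover have "finite (components (U - J)) \<and>
         card (components (U - J)) \<le> card (components U) + card (L ` (J \<inter> U))"
    using calculation by (intro card_components_Diff_le[OF U(1) _ U(2) _ near]) (auto simp: J_def)
  ultimately show ?thesis unfolding J_def by linarith
qed

section \<open>Arrangements of translates\<close>

text \<open>The first curve adds one component, and a curve added to \<open>k \<ge> 1\<close> others adds at most \<open>2k\<close>; the
  empty arrangement does not fit the formula, whence the case distinction.\<close>

lemma card_components_arrangement:
  fixes L :: "(real^2) set"
  assumes L: "convex_body L" "strictly_convex L" and "finite S"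
  shows "finite (components (- (\<Union>s\<in>S. (+) s ` frontier L))) \<and>
    card (components (- (\<Union>s\<in>S. (+) s ` frontier L))) \<le> (if S = {} then 1 else (card S)\<^sup>2 - card S + 2)"
  using \<open>finite S\<close>
proof induction
  case empty
  have "components (UNIV :: (real^2) set) = {UNIV}" by (simp add: components_eq_sing_iff)
  then show ?case by simp
next
  case (insert p S)
  have cl: "closed L" using L by (simp add: convex_body_def compact_imp_closed)
  define U where "U = - (\<Union>s\<in>S. (+) s ` frontier L)"
  define J where "J = (+) p ` frontier L"
  have J: "J = frontier ((+) p ` L)" by (simp add: J_def frontier_translation)
  have B: "convex_body ((+) p ` L)"
    using L by (auto simp: convex_body_def interior_translation compact_translation)
  have "open U" unfolding U_def using insert.hyps
    by (intro open_Compl closed_UN) (auto intro: closed_translation)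
  have pair: "finite (J \<inter> (+) s ` frontier L) \<and> card (J \<inter> (+) s ` frontier L) \<le> 2" if "s \<in> S" for s
  proof -
    have "p - s \<noteq> 0" using that insert.hyps by auto
    from frontier_inter_translate_card[OF cl L(2) this]
    have F: "finite (frontier L \<inter> (+) (p - s) ` frontier L)" "card (frontier L \<inter> (+) (p - s) ` frontier L) \<le> 2"
      by auto
    have "J \<inter> (+) s ` frontier L = (+) s ` (frontier L \<inter> (+) (p - s) ` frontier L)"
      by (simp add: J_def image_Int image_image algebra_simps Int_commute)
    then show ?thesis using F by (simp add: card_image)
  qed
  have JU: "J - U = (\<Union>s\<in>S. J \<inter> (+) s ` frontier L)" by (auto simp: U_def)
  have fin: "finite (J - U)" unfolding JU using pair insert.hyps(1) by (intro finite_UN_I) blast+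
  have "card (J - U) \<le> (\<Sum>s\<in>S. card (J \<inter> (+) s ` frontier L))"
    unfolding JU by (rule card_UN_le[OF insert.hyps(1)])
  also have "\<dots> \<le> (\<Sum>s\<in>S. 2)" using pair by (intro sum_mono) auto
  finally have cJ: "card (J - U) \<le> 2 * card S" by simp
  have eq: "- (\<Union>s\<in>insert p S. (+) s ` frontier L) = U - J" by (auto simp: U_def J_def)
  have IH: "finite (components U)" "card (components U) \<le> (if S = {} then 1 else (card S)\<^sup>2 - card S + 2)"
    using insert.IH by (auto simp: U_def)
  have main: "finite (components (U - J)) \<and>
    card (components (U - J)) \<le> card (components U) + max 1 (card (J - U))"
    using card_components_Diff_frontier_le[OF B \<open>open U\<close> IH(1)] fin unfolding J by blast
  have "card (components (U - J)) \<le> (card (insert p S))\<^sup>2 - card (insert p S) + 2"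
  proof (cases "S = {}")
    case True
    then show ?thesis using main IH cJ by simp
  next
    case False
    then have "card S \<ge> 1" using insert.hyps by (simp add: Suc_leI card_gt_0_iff)
    moreover have "card S \<le> (card S)\<^sup>2" by (simp add: power2_eq_square)
    ultimately have "(card S)\<^sup>2 - card S + 2 + max 1 (2 * card S) = (Suc (card S))\<^sup>2 - Suc (card S) + 2"
      by (simp add: power2_eq_square)
    then show ?thesis using main IH cJ False insert.hyps by auto
  qed
  then show ?case unfolding eq using main by simp
qed

section \<open>From traces to components\<close>

lemma interior_affinity:
  fixes K :: "'a::euclidean_space set"
  assumes "a \<noteq> 0"
  shows "interior ((\<lambda>x. w + a *\<^sub>R x) ` K) = (\<lambda>x. w + a *\<^sub>R x) ` interior K"
proof -
  have "interior ((+) w ` ((*\<^sub>R) a ` K)) = (+) w ` ((*\<^sub>R) a ` interior K)"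
    using assms by (simp add: interior_translation interior_injective_linear_image linear_scaleR injective_scaleR)
  then show ?thesis by (simp add: image_image)
qed

lemma convex_body_affinity:
  fixes K :: "'a::euclidean_space set"
  assumes "convex_body K" "a \<noteq> 0"
  shows "convex_body ((\<lambda>x. w + a *\<^sub>R x) ` K)"
  using assms by (auto simp: convex_body_def interior_affinity compact_affinity convex_affinity)

lemma strictly_convex_affinity:
  fixes K :: "'a::euclidean_space set"
  assumes "strictly_convex K" "a \<noteq> 0"
  shows "strictly_convex ((\<lambda>x. w + a *\<^sub>R x) ` K)"
  unfolding strictly_convex_def interior_affinity[OF assms(2)]
proof (intro ballI impI)
  fix x y l assume "x \<in> (\<lambda>x. w + a *\<^sub>R x) ` K" "y \<in> (\<lambda>x. w + a *\<^sub>R x) ` K" and l: "l \<in> {0<..<1::real}" and "x \<noteq> y"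
  then obtain u v where uv: "u \<in> K" "v \<in> K" "x = w + a *\<^sub>R u" "y = w + a *\<^sub>R v" "u \<noteq> v" by auto
  have "l *\<^sub>R x + (1 - l) *\<^sub>R y = w + a *\<^sub>R (l *\<^sub>R u + (1 - l) *\<^sub>R v)"
    by (simp add: uv algebra_simps)
  then show "l *\<^sub>R x + (1 - l) *\<^sub>R y \<in> (\<lambda>x. w + a *\<^sub>R x) ` interior K"
    using strictly_convexD[OF assms(1) uv(1,2,5)] l by auto
qed

text \<open>
  The homothety with centre \<open>c\<close> and ratio \<open>t < 1\<close> maps \<open>K\<close> into its interior. As \<open>t\<close> tends to \<open>1\<close>,
  the preimage \<open>c + (1 / t) *\<^sub>R (d - c)\<close> of an interior point \<open>d\<close> tends to \<open>d\<close>, so it is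
  interior for \<open>t\<close> close to \<open>1\<close>.
\<close>

lemma shrink_keeping_finitely_many:
  fixes K :: "'a::euclidean_space set"
  assumes "convex K" "c \<in> interior K" "finite D"
  obtains t :: real where "0 < t" "t < 1"
    "\<And>d. d \<in> D \<inter> interior K \<Longrightarrow> d \<in> (\<lambda>y. (1 - t) *\<^sub>R c + t *\<^sub>R y) ` interior K"
    "(\<lambda>y. (1 - t) *\<^sub>R c + t *\<^sub>R y) ` K \<subseteq> interior K"
proof -
  have ev: "eventually (\<lambda>t. c + (1 / t) *\<^sub>R (d - c) \<in> interior K) (at_left 1)" if "d \<in> interior K" for d
  proof -
    have "((\<lambda>t. c + (1 / t) *\<^sub>R (d - c)) \<longlongrightarrow> c + (1 / 1) *\<^sub>R (d - c)) (at_left (1::real))"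
      by (intro tendsto_intros) auto
    then show ?thesis using that topological_tendstoD[OF _ open_interior] by fastforce
  qed
  have "eventually (\<lambda>t. \<forall>d \<in> D \<inter> interior K. c + (1 / t) *\<^sub>R (d - c) \<in> interior K) (at_left 1)"
    using assms(3) ev by (intro eventually_ball_finite) auto
  moreover have "eventually (\<lambda>t::real. t \<in> {0<..<1}) (at_left 1)"
    by (rule eventually_at_left_real) simp
  ultimately have "eventually (\<lambda>t. t \<in> {0<..<1} \<and> (\<forall>d \<in> D \<inter> interior K. c + (1 / t) *\<^sub>R (d - c) \<in> interior K)) (at_left 1)"
    by eventually_elim auto
  then obtain t where t: "0 < t" "t < 1" and
    D: "\<And>d. d \<in> D \<inter> interior K \<Longrightarrow> c + (1 / t) *\<^sub>R (d - c) \<in> interior K"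
    using eventually_happens'[OF trivial_limit_at_left_real] by (metis (no_types, lifting) greaterThanLessThan_iff)
  show thesis
  proof
    fix d assume d: "d \<in> D \<inter> interior K"
    have "d = (1 - t) *\<^sub>R c + t *\<^sub>R (c + (1 / t) *\<^sub>R (d - c))" using t by (simp add: algebra_simps)
    then show "d \<in> (\<lambda>y. (1 - t) *\<^sub>R c + t *\<^sub>R y) ` interior K" using D[OF d] by blast
  next
    show "(\<lambda>y. (1 - t) *\<^sub>R c + t *\<^sub>R y) ` K \<subseteq> interior K"
    proof clarify
      fix y assume "y \<in> K"
      then have "y - (1 - t) *\<^sub>R (y - c) \<in> interior K"
        using assms t by (intro mem_interior_convex_shrink) auto
      then show "(1 - t) *\<^sub>R c + t *\<^sub>R y \<in> interior K" by (simp add: algebra_simps)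
    qed
  qed (use t in auto)
qed

text \<open>
  The set \<open>X\<close> contains one translation vector for each trace, and \<open>L\<close> is the shrunk body reflected
  in the origin. No point of \<open>X\<close> is on a boundary \<open>s + frontier L\<close>, and two points of \<open>X\<close> in the same
  component of the complement of these boundaries would lie in the same translates of \<open>L\<close>,
  hence have the same trace.
\<close>

lemma card_traces_translates_le:
  fixes K :: "(real^2) set"
  assumes K: "convex_body K" "strictly_convex K" and S: "finite S" "S \<noteq> {}"
  shows "card (traces (translates (interior K)) S) \<le> (card S)\<^sup>2 - card S + 2"
proof -
  define T where "T = traces (translates (interior K)) S"
  define tr where "tr x = {s \<in> S. s - x \<in> interior K}" for x
  have "S \<inter> (+) x ` interior K = tr x" for x
    by (force simp: tr_def image_iff)
  then have T: "T = range tr" by (auto simp: T_def traces_def translates_def)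
  have finT: "finite T" unfolding T using S by (auto intro: finite_subset[of _ "Pow S"] simp: tr_def)
  obtain X where X: "inj_on tr X" "T = tr ` X"
    using subset_image_inj[of T tr UNIV] T by auto
  then have "finite X" using finT finite_imageD by blast
  obtain c where c: "c \<in> interior K" using K by (auto simp: convex_body_def)
  have "convex K" using K by (simp add: convex_body_def)
  obtain t where t: "0 < t" "t < 1"
    and inn: "\<And>d. d \<in> (\<lambda>(s, x). s - x) ` (S \<times> X) \<inter> interior K \<Longrightarrow> d \<in> (\<lambda>y. (1 - t) *\<^sub>R c + t *\<^sub>R y) ` interior K"
    and outt: "(\<lambda>y. (1 - t) *\<^sub>R c + t *\<^sub>R y) ` K \<subseteq> interior K"
    using shrink_keeping_finitely_many[OF \<open>convex K\<close> c, of "(\<lambda>(s, x). s - x) ` (S \<times> X)"] S \<open>finite X\<close> by blast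
  define f where "f y = - ((1 - t) *\<^sub>R c) + (- t) *\<^sub>R y" for y
  define L where "L = f ` K"
  have "- t \<noteq> 0" using t by simp
  then have L: "convex_body L" "strictly_convex L" and intL: "interior L = f ` interior K"
    unfolding L_def f_def
    by (rule convex_body_affinity[OF K(1)] strictly_convex_affinity[OF K(2)] interior_affinity)+
  have cl: "closed L" using L by (simp add: convex_body_def compact_imp_closed)
  define U where "U = - (\<Union>s\<in>S. (+) s ` frontier L)"
  have memf: "x \<in> (+) s ` f ` Y \<longleftrightarrow> s - x \<in> (\<lambda>y. (1 - t) *\<^sub>R c + t *\<^sub>R y) ` Y" for x s Y
    by (force simp: f_def image_iff algebra_simps)
  have 1: "x \<in> (+) s ` interior L" if "x \<in> X" "s \<in> S" "s \<in> tr x" for x s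
    unfolding intL memf using that inn[of "s - x"] by (force simp: tr_def)
  have 2: "x \<notin> (+) s ` L" if "s \<in> S" "s \<notin> tr x" for x s
    unfolding L_def memf using that outt by (auto simp: tr_def)
  have XU: "X \<subseteq> U" using 1 2 cl by (fastforce simp: U_def frontier_def)
  have "inj_on (connected_component_set U) X"
  proof (rule inj_onI)
    fix x y assume xy: "x \<in> X" "y \<in> X" "connected_component_set U x = connected_component_set U y"
    define Z where "Z = connected_component_set U x"
    have "x \<in> U" "y \<in> U" using xy XU by blast+
    then have Z: "connected Z" "x \<in> Z" "Z \<subseteq> U"
      by (auto simp: Z_def connected_component_subset)
    have "y \<in> Z" unfolding Z_def xy(3) using \<open>y \<in> U\<close> by simp
    have same: "u \<in> (+) s ` L \<longleftrightarrow> v \<in> (+) s ` L" if "s \<in> S" "u \<in> Z" "v \<in> Z" for s u v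
    proof -
      have "Z \<inter> frontier ((+) s ` L) = {}" using Z(3) that by (auto simp: U_def frontier_translation)
      then show ?thesis using connected_Int_frontier[OF Z(1), of "(+) s ` L"] that by blast
    qed
    have tr: "s \<in> tr z \<longleftrightarrow> z \<in> (+) s ` L" if "z \<in> X" "s \<in> S" for s z
      using 1 2 that interior_subset by blast
    have "tr x = tr y"
      using tr same[OF _ Z(2) \<open>y \<in> Z\<close>] xy by (auto simp: tr_def)
    then show "x = y" using X xy by (auto dest: inj_onD)
  qed
  then have "card X \<le> card (components U)"
    using card_components_arrangement[OF L S(1)] XU
    by (intro card_inj_on_le[of "connected_component_set U"]) (auto simp: U_def intro: componentsI)
  moreover have "card T = card X" using X by (simp add: card_image)
  ultimately show ?thesis
    using card_components_arrangement[OF L S(1)] S(2) by (simp add: T_def U_def)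
qed

theorem proposition4p14:
  fixes C K :: "(real ^ 2) set" and n :: nat
  assumes "convex_body K" and "strictly_convex K"
    and "C = interior K"
    and "n \<ge> 1"
  shows "growth_function UNIV (translates C) n \<le> n ^ 2 - n + 2"
proof -
  have "infinite (UNIV :: (real^2) set)"
    using finite_imp_bounded not_bounded_UNIV by blast
  from Max_in[OF growth_function_max_attained[OF this, of "translates C" n]]
  obtain S :: "(real^2) set" where "finite S" "card S = n"
    "growth_function UNIV (translates C) n = card (traces (translates C) S)"
    unfolding growth_function_def by auto
  moreover have "S \<noteq> {}" using calculation assms(4) by auto
  ultimately show ?thesis using card_traces_translates_le[OF assms(1,2)] assms(3) by metis
qed

end
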